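(* Let $d\ge 1$ be an integer and let $\lambda>0$. For $j=(j_1,\dots,j_d)\in\mathbb{Z}^d$ put $z_j=C_{d,\lambda}\prod_{k=1}^d K_{j_k}\left(\frac{1}{2\lambda}\right)$, where $C_{d,\lambda}>0$ is a constant. Let $u=(u_j)_{j\in\mathbb{Z}^d}$ be a solution on $[0,1]$ of the free discrete Schr\"odinger equation $$\partial_t u_j=i\Delta_d u_j=i\sum_{k=1}^d(u_{j+e_k}-2u_j+u_{j-e_k}),\qquad j\in\mathbb{Z}^d,$$ such that $$\sum_{j\in\mathbb{Z}^d}z_j^2|u_j(0)|^2+\sum_{j\in\mathbb{Z}^d}z_j^2|u_j(1)|^2<+\infty.$$ Then $$H(t)=\sum_{j\in\mathbb{Z}^d}z_j^2|u_j(t)|^2$$ is logarithmically convex on $[0,1]$.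
   Context: $e_1,\dots,e_d$ is the standard basis of $\mathbb{Z}^d$. For $m\in\mathbb{Z}$ and $x>0$, $K_m(x)=\int_0^\infty e^{-x\cosh t}\cosh(mt)\,dt$ is the modified Bessel function of the second kind. A solution on $[0,1]$ means a complex-valued $u\in C([0,1];\ell^2(\mathbb{Z}^d))$ whose components satisfy the equation. A function $H:[0,1]\to[0,\infty)$ is logarithmically convex if $H((1-s)t_0+st_1)\le H(t_0)^{1-s}H(t_1)^s$ for all $t_0,t_1\in[0,1]$ and $s\in(0,1)$; in particular $H$ is finite on $[0,1]$. *)

theory Defs
  imports "HOL-Analysis.Analysis"
begin

definition bessel_K :: "int \<Rightarrow> real \<Rightarrow> real" where
  "bessel_K m x = (LBINT t:{0..}. exp (- x * cosh t) * cosh (real_of_int m * t))"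

text \<open>The lattice is \<open>int ^ 'd\<close>, so that the dimension is \<open>CARD('d) \<ge> 1\<close> and the
  \<open>k\<close>-th standard basis vector is \<open>axis k 1\<close>.\<close>

definition discrete_laplacian :: "(int ^ 'd::finite \<Rightarrow> complex) \<Rightarrow> int ^ 'd \<Rightarrow> complex" where
  "discrete_laplacian f j = (\<Sum>k\<in>UNIV. f (j + axis k 1) - 2 * f j + f (j - axis k 1))"

definition in_l2 :: "('a \<Rightarrow> complex) \<Rightarrow> bool" where
  "in_l2 f \<longleftrightarrow> (\<lambda>j. (cmod (f j))\<^sup>2) summable_on UNIV"

definition l2_norm :: "('a \<Rightarrow> complex) \<Rightarrow> real" where
  "l2_norm f = sqrt (\<Sum>\<^sub>\<infinity>j. (cmod (f j))\<^sup>2)"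

definition l2_continuous_on :: "real set \<Rightarrow> (real \<Rightarrow> 'a \<Rightarrow> complex) \<Rightarrow> bool" where
  "l2_continuous_on S u \<longleftrightarrow>
     (\<forall>t\<in>S. in_l2 (u t)) \<and>
     (\<forall>t\<in>S. ((\<lambda>s. l2_norm (\<lambda>j. u s j - u t j)) \<longlongrightarrow> 0) (at t within S))"

text \<open>Derivatives at the endpoints of the time interval are one-sided.\<close>

definition free_schroedinger_solution :: "(real \<Rightarrow> int ^ 'd::finite \<Rightarrow> complex) \<Rightarrow> bool" where
  "free_schroedinger_solution u \<longleftrightarrow>
     l2_continuous_on {0..1} u \<and>
     (\<forall>j. \<forall>t\<in>{0..1}.
        ((\<lambda>s. u s j) has_vector_derivative \<i> * discrete_laplacian (u t) j) (at t within {0..1}))"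

text \<open>\<open>C\<close> is the positive constant (depending on the dimension and \<open>l\<close>) in the weight.\<close>

definition bessel_weight :: "real \<Rightarrow> real \<Rightarrow> int ^ 'd::finite \<Rightarrow> real" where
  "bessel_weight C l j = C * (\<Prod>k\<in>UNIV. bessel_K (j $ k) (1 / (2 * l)))"

text \<open>Note \<open>0 powr s = 0\<close>, which is the intended value of \<open>0\<^sup>s\<close> for \<open>0 < s\<close>.\<close>

definition log_convex_unit_interval :: "(real \<Rightarrow> real) \<Rightarrow> bool" where
  "log_convex_unit_interval H \<longleftrightarrow>
     (\<forall>t\<in>{0..1}. 0 \<le> H t) \<and>
     (\<forall>t0\<in>{0..1}. \<forall>t1\<in>{0..1}. \<forall>s\<in>{0<..<1}.
        H ((1 - s) * t0 + s * t1) \<le> H t0 powr (1 - s) * H t1 powr s)"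

end

theory Submission
  imports Defs
begin

text \<open>Since \<open>K\<^sub>m(x)\<close> is a positive mixture over \<open>t \<in> \<real>\<close> of the exponentials \<open>m \<mapsto> exp (m * t)\<close>,
  the weight \<open>z\<^sub>j\<^sup>2\<close> is a positive mixture of exponentials \<open>exp (2 * (s \<bullet> j))\<close>, \<open>s \<in> \<real>\<^sup>d\<close>.
  For such a weight, \<open>f = exp (s \<bullet> j) * u\<close> solves \<open>f' = L f\<close> in \<open>\<ell>\<^sup>2\<close> with \<open>L\<close> bounded and normal,
  a property shared by \<open>exp (c * t / 2) * f\<close>; hence \<open>exp (c * t) * (norm f)\<^sup>2\<close> is convex for
  every real \<open>c\<close>. Convexity is an inequality linear in the weight, so it can be
  integrated over \<open>s\<close>, and optimising over \<open>c\<close> afterwards gives logarithmic convexity. That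
  finiteness of the tilted energy propagates from one time to all others follows from the Taylor
  series of \<open>u\<^sub>j\<close> in time and Fatou's lemma.\<close>

section \<open>The Hilbert space of square-summable functions\<close>

lemma in_l2_zero: "in_l2 (\<lambda>_. 0)"
  by (simp add: in_l2_def)

lemma in_l2_scale: "in_l2 f \<Longrightarrow> in_l2 (\<lambda>j. c * f j)"
  unfolding in_l2_def by (simp add: norm_mult power_mult_distrib summable_on_cmult_right)

lemma in_l2_add:
  assumes "in_l2 f" "in_l2 g"
  shows "in_l2 (\<lambda>j. f j + g j)"
  unfolding in_l2_def
proof (rule summable_on_comparison_test)
  show "(\<lambda>j. 2 * (cmod (f j))\<^sup>2 + 2 * (cmod (g j))\<^sup>2) summable_on UNIV"
    using assms unfolding in_l2_def by (intro summable_on_add summable_on_cmult_right)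
  have *: "(x + y)\<^sup>2 \<le> 2 * x\<^sup>2 + 2 * y\<^sup>2" for x y :: real
    using sum_squares_bound[of x y] by (simp add: power2_sum)
  show "(cmod (f j + g j))\<^sup>2 \<le> 2 * (cmod (f j))\<^sup>2 + 2 * (cmod (g j))\<^sup>2" for j
    by (rule order_trans[OF power_mono[OF norm_triangle_ineq] *]) simp
qed auto

lemma in_l2_shift:
  fixes a :: "'a::group_add"
  assumes "in_l2 f" shows "in_l2 (\<lambda>j. f (j + a))"
  using assms unfolding in_l2_def
  by (subst (asm) summable_on_reindex_bij_betw[of "\<lambda>j. j + a" UNIV UNIV, symmetric])
     (auto intro!: bij_betwI[where g="\<lambda>j. j - a"])

lemma summable_on_inner_l2:
  assumes "in_l2 f" "in_l2 g"
  shows "(\<lambda>j. f j \<bullet> g j) summable_on UNIV"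
proof (rule abs_summable_summable, rule summable_on_comparison_test)
  show "(\<lambda>j. (cmod (f j))\<^sup>2 + (cmod (g j))\<^sup>2) summable_on UNIV"
    using assms unfolding in_l2_def by (intro summable_on_add)
  show "norm (f j \<bullet> g j) \<le> (cmod (f j))\<^sup>2 + (cmod (g j))\<^sup>2" for j
  proof -
    have "norm (f j \<bullet> g j) \<le> cmod (f j) * cmod (g j)"
      using Cauchy_Schwarz_ineq2[of "f j" "g j"] by simp
    also have "\<dots> \<le> (cmod (f j))\<^sup>2 + (cmod (g j))\<^sup>2"
      using sum_squares_bound[of "cmod (f j)" "cmod (g j)"]
        mult_nonneg_nonneg[OF norm_ge_zero[of "f j"] norm_ge_zero[of "g j"]]
      by linarith
    finally show ?thesis .
  qed
qed auto

text \<open>The space is made a real inner product space, with pairing Re (f j * cnj (g j)) summed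
  over j; complex scalars enter only through the operator of multiplication by i. Limits are taken
  coordinatewise, through \<open>l2_Fatou\<close>, rather than by completeness.\<close>

typedef 'a l2 = "{f :: 'a \<Rightarrow> complex. in_l2 f}"
  morphisms coord l2_of
  using in_l2_zero by blast

setup_lifting type_definition_l2

lemma in_l2_coord [simp]: "in_l2 (coord x)"
  using coord by blast

lemma l2_eqI: "(\<And>j. coord x j = coord y j) \<Longrightarrow> x = y"
  by transfer auto

instantiation l2 :: (type) real_inner
begin

lift_definition zero_l2 :: "'a l2" is "\<lambda>_. 0" by (rule in_l2_zero)

lift_definition plus_l2 :: "'a l2 \<Rightarrow> 'a l2 \<Rightarrow> 'a l2" is "\<lambda>f g j. f j + g j"
  by (rule in_l2_add)

lift_definition uminus_l2 :: "'a l2 \<Rightarrow> 'a l2" is "\<lambda>f j. - f j"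
  using in_l2_scale[of _ "- 1"] by simp

lift_definition minus_l2 :: "'a l2 \<Rightarrow> 'a l2 \<Rightarrow> 'a l2" is "\<lambda>f g j. f j - g j"
  subgoal for f g using in_l2_add[OF _ in_l2_scale, of f g "- 1"] by simp
  done

lift_definition scaleR_l2 :: "real \<Rightarrow> 'a l2 \<Rightarrow> 'a l2" is "\<lambda>r f j. r *\<^sub>R f j"
  by (simp add: scaleR_conv_of_real in_l2_scale)

lift_definition inner_l2 :: "'a l2 \<Rightarrow> 'a l2 \<Rightarrow> real" is "\<lambda>f g. \<Sum>\<^sub>\<infinity>j. f j \<bullet> g j" .

definition norm_l2 :: "'a l2 \<Rightarrow> real" where "norm_l2 x = sqrt (x \<bullet> x)"
definition dist_l2 :: "'a l2 \<Rightarrow> 'a l2 \<Rightarrow> real" where "dist_l2 x y = norm (x - y)"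
definition sgn_l2 :: "'a l2 \<Rightarrow> 'a l2" where "sgn_l2 x = inverse (norm x) *\<^sub>R x"
definition uniformity_l2 :: "('a l2 \<times> 'a l2) filter"
  where "uniformity_l2 = (INF e\<in>{0 <..}. principal {(x, y). dist x y < e})"
definition open_l2 :: "'a l2 set \<Rightarrow> bool"
  where "open_l2 U \<longleftrightarrow> (\<forall>x\<in>U. \<forall>\<^sub>F (x', y) in uniformity. x' = x \<longrightarrow> y \<in> U)"

instance
proof
  fix x y z :: "'a l2" and r s :: real
  show "x + y + z = x + (y + z)" "x + y = y + x" "0 + x = x" "- x + x = 0" "x - y = x + - y"
    "r *\<^sub>R (x + y) = r *\<^sub>R x + r *\<^sub>R y" "(r + s) *\<^sub>R x = r *\<^sub>R x + s *\<^sub>R x"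
    "r *\<^sub>R s *\<^sub>R x = (r * s) *\<^sub>R x" "1 *\<^sub>R x = x"
    by (transfer; simp add: fun_eq_iff algebra_simps; fail)+
  show "dist x y = norm (x - y)" "sgn x = inverse (norm x) *\<^sub>R x" "norm x = sqrt (x \<bullet> x)"
    "uniformity = (INF e\<in>{0<..}. principal {(x, y :: 'a l2). dist x y < e})"
    "\<And>U :: 'a l2 set. open U \<longleftrightarrow> (\<forall>x\<in>U. \<forall>\<^sub>F (x', y) in uniformity. x' = x \<longrightarrow> y \<in> U)"
    by (simp_all add: dist_l2_def sgn_l2_def norm_l2_def uniformity_l2_def open_l2_def)
  show "x \<bullet> y = y \<bullet> x"
    by transfer (simp add: inner_commute)
  show "(x + y) \<bullet> z = x \<bullet> z + y \<bullet> z"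
    by transfer (simp add: inner_add_left infsum_add summable_on_inner_l2)
  show "(r *\<^sub>R x) \<bullet> y = r * (x \<bullet> y)"
    by transfer (simp add: infsum_cmult_right')
  show "0 \<le> x \<bullet> x"
    by transfer (simp add: infsum_nonneg)
  show "x \<bullet> x = 0 \<longleftrightarrow> x = 0"
  proof transfer
    fix f :: "'a \<Rightarrow> complex" assume f: "in_l2 f"
    show "(\<Sum>\<^sub>\<infinity>j. f j \<bullet> f j) = 0 \<longleftrightarrow> f = (\<lambda>_. 0)"
    proof
      assume 0: "(\<Sum>\<^sub>\<infinity>j. f j \<bullet> f j) = 0"
      show "f = (\<lambda>_. 0)"
      proof
        fix j
        have "f j \<bullet> f j = 0"
          by (rule nonneg_infsum_le_0D[of "\<lambda>j. f j \<bullet> f j" UNIV])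
             (simp_all add: 0 summable_on_inner_l2[OF f f])
        then show "f j = 0" by simp
      qed
    qed simp
  qed
qed

end

section \<open>Coordinates, norms and coordinatewise limits\<close>

lemma coord_simps [simp]:
  "coord 0 j = 0" "coord (x + y) j = coord x j + coord y j" "coord (- x) j = - coord x j"
  "coord (x - y) j = coord x j - coord y j" "coord (r *\<^sub>R x) j = r *\<^sub>R coord x j"
  by (transfer; simp)+

lemma coord_sum [simp]: "coord (sum f A) j = (\<Sum>i\<in>A. coord (f i) j)"
  by (induction A rule: infinite_finite_induct) auto

lemma norm_l2_power2: "(norm x)\<^sup>2 = (\<Sum>\<^sub>\<infinity>j. (cmod (coord x j))\<^sup>2)"
  by (simp add: power2_norm_eq_inner inner_l2.rep_eq)

lemma norm_l2_eq: "norm x = l2_norm (coord x)"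
  by (simp add: l2_norm_def norm_l2_power2[symmetric])

lemma coord_summable: "(\<lambda>j. (cmod (coord x j))\<^sup>2) summable_on UNIV"
  using in_l2_coord[of x] by (simp add: in_l2_def)

lemma norm_coord_le: "cmod (coord x j) \<le> norm x"
proof -
  have "(\<Sum>i\<in>{j}. (cmod (coord x i))\<^sup>2) \<le> (\<Sum>\<^sub>\<infinity>i. (cmod (coord x i))\<^sup>2)"
    by (rule finite_sum_le_infsum) (auto simp: coord_summable)
  then show ?thesis
    by (simp add: norm_l2_power2[symmetric] power2_le_iff_abs_le)
qed

text \<open>Fatou's lemma for counting measure: each finite partial sum of the squared moduli of
  \<open>v\<close> is a limit of partial sums bounded by the square of \<open>c\<close>. Thus a
  bounded sequence needs only coordinatewise convergence for its limit to lie in the space.\<close>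

lemma l2_Fatou:
  assumes lim: "\<And>j. (\<lambda>n. coord (X n) j) \<longlonglongrightarrow> v j" and bd: "\<And>n. norm (X n) \<le> c"
  shows "in_l2 v" and "norm (l2_of v) \<le> c"
proof -
  have c: "0 \<le> c" using bd[of 0] norm_ge_zero order_trans by blast
  have fin: "(\<Sum>j\<in>A. (cmod (v j))\<^sup>2) \<le> c\<^sup>2" if "finite A" for A
  proof (rule LIMSEQ_le_const2)
    show "(\<lambda>n. \<Sum>j\<in>A. (cmod (coord (X n) j))\<^sup>2) \<longlonglongrightarrow> (\<Sum>j\<in>A. (cmod (v j))\<^sup>2)"
      by (intro tendsto_intros lim)
    have "(\<Sum>j\<in>A. (cmod (coord (X n) j))\<^sup>2) \<le> c\<^sup>2" for n
    proof -
      have "(\<Sum>j\<in>A. (cmod (coord (X n) j))\<^sup>2) \<le> (norm (X n))\<^sup>2"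
        unfolding norm_l2_power2
        by (rule finite_sum_le_infsum) (auto simp: coord_summable that)
      also have "\<dots> \<le> c\<^sup>2" using bd by (intro power_mono) auto
      finally show ?thesis .
    qed
    then show "\<exists>N. \<forall>n\<ge>N. (\<Sum>j\<in>A. (cmod (coord (X n) j))\<^sup>2) \<le> c\<^sup>2" by blast
  qed
  show v: "in_l2 v"
    unfolding in_l2_def
    by (rule nonneg_bdd_above_summable_on) (auto intro!: bdd_aboveI2[where M="c\<^sup>2"] fin)
  have "(norm (l2_of v))\<^sup>2 \<le> c\<^sup>2"
    using v fin by (auto simp: norm_l2_power2 l2_of_inverse in_l2_def intro!: infsum_le_finite_sums)
  then show "norm (l2_of v) \<le> c" using c by (simp add: power2_le_iff_abs_le)
qed

section \<open>Convexity along the flow of a normal operator\<close>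

text \<open>The mean value theorem on either side of an intermediate point compares the two slopes.
  Derivatives are asked for only in the interior, since at the ends of the time interval they are
  one-sided.\<close>

lemma convex_on_Icc_derivI:
  fixes h h' :: "real \<Rightarrow> real"
  assumes cont: "continuous_on {a..b} h"
    and der: "\<And>x. a < x \<Longrightarrow> x < b \<Longrightarrow> (h has_real_derivative h' x) (at x)"
    and mono: "\<And>x y. a < x \<Longrightarrow> x \<le> y \<Longrightarrow> y < b \<Longrightarrow> h' x \<le> h' y"
  shows "convex_on {a..b} h"
proof (rule convex_on_linorderI)
  fix t x y :: real
  assume t: "0 < t" "t < 1" and xy: "x \<in> {a..b}" "y \<in> {a..b}" "x < y"
  define z where "z = (1 - t) * x + t * y"
  have zx: "z - x = t * (y - x)" and yz: "y - z = (1 - t) * (y - x)"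
    by (simp_all add: z_def algebra_simps)
  have "0 < z - x" "0 < y - z"
    unfolding zx yz using t xy by (simp_all only: mult_pos_pos diff_gt_0_iff_gt)
  then have "x < z" "z < y" by auto
  have mvt: "\<exists>\<xi>. u < \<xi> \<and> \<xi> < v \<and> h v - h u = h' \<xi> * (v - u)" if "a \<le> u" "u < v" "v \<le> b" for u v
  proof -
    have "continuous_on {u..v} h" using that by (intro continuous_on_subset[OF cont]) auto
    moreover have "(h has_derivative (*) (h' \<xi>)) (at \<xi>)" if "u < \<xi>" "\<xi> < v" for \<xi>
      using der[of \<xi>] that \<open>a \<le> u\<close> \<open>v \<le> b\<close> by (simp add: has_field_derivative_def)
    ultimately obtain \<xi> where "u < \<xi>" "\<xi> < v" "h v - h u = h' \<xi> * (v - u)"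
      using mvt[OF \<open>u < v\<close>, of h "\<lambda>\<xi>. (*) (h' \<xi>)"] by blast
    then show ?thesis by blast
  qed
  obtain p where p: "x < p" "p < z" "h z - h x = h' p * (z - x)"
    using mvt[of x z] xy \<open>x < z\<close> \<open>z < y\<close> by auto
  obtain q where q: "z < q" "q < y" "h y - h z = h' q * (y - z)"
    using mvt[of z y] xy \<open>x < z\<close> \<open>z < y\<close> by auto
  have "h' p \<le> h' q" using p q xy by (intro mono) auto
  \<comment> \<open>The common factor is (1 - t) * (z - x) = t * (y - z), so both sides become
    weighted increments of \<open>h\<close>.\<close>
  then have "(1 - t) * (t * (y - x)) * h' p \<le> (1 - t) * (t * (y - x)) * h' q"
    using t xy by (intro mult_left_mono) auto
  then have "(1 - t) * (h z - h x) \<le> t * (h y - h z)"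
    unfolding p q zx yz by (simp add: mult_ac)
  then have "h z \<le> (1 - t) * h x + t * h y" by (simp add: algebra_simps)
  then show "h ((1 - t) *\<^sub>R x + t *\<^sub>R y) \<le> (1 - t) * h x + t * h y"
    by (simp add: z_def)
qed simp

text \<open>The second derivative of the squared norm is \<open>(norm (L x + L' x))\<^sup>2\<close>; normality is what
  turns the two diagonal terms into a perfect square.\<close>

lemma convex_on_norm_power2_normal_flow:
  fixes f :: "real \<Rightarrow> 'a::real_inner" and L L' :: "'a \<Rightarrow> 'a"
  assumes L: "bounded_linear L"
    and adj: "\<And>x y. L x \<bullet> y = x \<bullet> L' y"
    and normal: "\<And>x. L (L' x) = L' (L x)"
    and f: "\<And>t. t \<in> {a..b} \<Longrightarrow> (f has_vector_derivative L (f t)) (at t within {a..b})"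
  shows "convex_on {a..b} (\<lambda>t. (norm (f t))\<^sup>2)"
proof (rule convex_on_Icc_derivI)
  have "continuous_on {a..b} f"
    using f by (meson continuous_on_eq_continuous_within has_vector_derivative_continuous)
  then show "continuous_on {a..b} (\<lambda>t. (norm (f t))\<^sup>2)"
    by (intro continuous_intros)
  have f': "(f has_vector_derivative L (f t)) (at t)" if "a < t" "t < b" for t
    using f[of t] that by (simp add: at_within_Icc_at)
  have Lf': "((\<lambda>t. L (f t)) has_vector_derivative L (L (f t))) (at t)" if "a < t" "t < b" for t
    by (rule bounded_linear.has_vector_derivative[OF L f'[OF that]])
  have inner': "((\<lambda>t. g t \<bullet> k t) has_real_derivative g t \<bullet> k' + g' \<bullet> k t) (at t)"
    if "(g has_vector_derivative g') (at t)" "(k has_vector_derivative k') (at t)"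
    for g k :: "real \<Rightarrow> 'a" and g' k' t
    using bounded_bilinear.has_vector_derivative[OF bounded_bilinear_inner that]
    by (simp add: has_real_derivative_iff_has_vector_derivative)
  show "((\<lambda>t. (norm (f t))\<^sup>2) has_real_derivative 2 * (f t \<bullet> L (f t))) (at t)"
    if "a < t" "t < b" for t
    using inner'[OF f' f', OF that that] by (simp add: power2_norm_eq_inner inner_commute)
  have d2: "((\<lambda>t. 2 * (f t \<bullet> L (f t))) has_real_derivative (norm (L (f t) + L' (f t)))\<^sup>2) (at t)"
    if "a < t" "t < b" for t
  proof -
    have 1: "((\<lambda>t. 2 * (f t \<bullet> L (f t))) has_real_derivative
        2 * (f t \<bullet> L (L (f t)) + L (f t) \<bullet> L (f t))) (at t)"
      by (rule DERIV_cmult[OF inner'[OF f' Lf', OF that that]])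
    have LL: "x \<bullet> L (L x) = L' x \<bullet> L x" for x
      by (metis adj inner_commute)
    have "L x \<bullet> L x = L' x \<bullet> L' x" for x
      by (metis adj inner_commute normal)
    then have "2 * (x \<bullet> L (L x) + L x \<bullet> L x) = (norm (L x + L' x))\<^sup>2" for x
      unfolding power2_norm_eq_inner LL by (simp add: inner_simps inner_commute)
    with 1 show ?thesis by simp
  qed
  show "2 * (f x \<bullet> L (f x)) \<le> 2 * (f y \<bullet> L (f y))" if "a < x" "x \<le> y" "y < b" for x y
    using that by (intro DERIV_nonneg_imp_nondecreasing[OF \<open>x \<le> y\<close>])
      (metis d2 order_less_le_trans order_le_less_trans zero_le_power2)
qed

section \<open>The tilted generator\<close>

lift_definition l2_shift :: "'a::group_add \<Rightarrow> 'a l2 \<Rightarrow> 'a l2" is "\<lambda>a f j. f (j + a)"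
  by (rule in_l2_shift)

lift_definition l2_times_i :: "'a l2 \<Rightarrow> 'a l2" is "\<lambda>f j. \<i> * f j"
  by (rule in_l2_scale)

lemma coord_l2_shift [simp]: "coord (l2_shift a x) j = coord x (j + a)"
  by transfer simp

lemma coord_l2_times_i [simp]: "coord (l2_times_i x) j = \<i> * coord x j"
  by transfer simp

lemma inner_l2_shift: "l2_shift a x \<bullet> y = x \<bullet> l2_shift (- a) y"
proof transfer
  fix a :: 'a and f g :: "'a \<Rightarrow> complex"
  have "bij (\<lambda>j. j + a)"
    by (rule bij_betwI[where g = "\<lambda>j. j - a"]) auto
  then show "(\<Sum>\<^sub>\<infinity>j. f (j + a) \<bullet> g j) = (\<Sum>\<^sub>\<infinity>j. f j \<bullet> g (j + - a))"
    using infsum_reindex_bij_betw[of "\<lambda>j. j + a" UNIV UNIV "\<lambda>j. f j \<bullet> g (j - a)"]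
    by (simp add: add.assoc)
qed

lemma inner_l2_times_i: "l2_times_i x \<bullet> y = - (x \<bullet> l2_times_i y)"
  by transfer (simp add: inner_complex_def infsum_uminus[symmetric])

lemma norm_l2_shift [simp]: "norm (l2_shift a x) = norm x"
proof -
  have "l2_shift (- a) (l2_shift a x) = x"
    by (rule l2_eqI) simp
  then show ?thesis by (simp add: norm_eq_sqrt_inner inner_l2_shift)
qed

lemma norm_l2_times_i [simp]: "norm (l2_times_i x) = norm x"
  by (rule power2_eq_imp_eq) (simp_all add: norm_l2_power2 norm_mult)

lemma bounded_linear_l2_shift: "bounded_linear (l2_shift a)"
  by (rule bounded_linear_intro[where K=1]) (auto intro: l2_eqI)

lemma bounded_linear_l2_times_i: "bounded_linear l2_times_i"
  by (rule bounded_linear_intro[where K=1]) (auto intro: l2_eqI simp: algebra_simps)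

text \<open>The \<open>k\<close>-th summand of the discrete Laplacian after conjugation by \<open>exp (s \<bullet> j)\<close>.\<close>

definition tilted_hop :: "real ^ 'd \<Rightarrow> 'd \<Rightarrow> (int ^ 'd::finite) l2 \<Rightarrow> (int ^ 'd) l2" where
  "tilted_hop s k x = exp (- s $ k) *\<^sub>R l2_shift (axis k 1) x - 2 *\<^sub>R x
     + exp (s $ k) *\<^sub>R l2_shift (- axis k 1) x"

definition tilted_gen :: "real ^ 'd \<Rightarrow> (int ^ 'd::finite) l2 \<Rightarrow> (int ^ 'd) l2" where
  "tilted_gen s x = l2_times_i (\<Sum>k\<in>UNIV. tilted_hop s k x)"

lemma bounded_linear_tilted_hop: "bounded_linear (tilted_hop s k)"
  unfolding tilted_hop_def
  by (intro bounded_linear_add bounded_linear_sub bounded_linear_const_scaleR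
      bounded_linear_l2_shift bounded_linear_ident)

lemma bounded_linear_tilted_gen: "bounded_linear (tilted_gen s)"
  unfolding tilted_gen_def
  by (intro bounded_linear_compose[OF bounded_linear_l2_times_i] bounded_linear_sum
      bounded_linear_tilted_hop)

lemma l2_times_i_sum: "l2_times_i (sum f A) = (\<Sum>k\<in>A. l2_times_i (f k))"
  by (rule l2_eqI) (simp add: sum_distrib_left)

lemma tilted_hop_times_i: "tilted_hop s k (l2_times_i x) = l2_times_i (tilted_hop s k x)"
  by (rule l2_eqI) (simp add: tilted_hop_def algebra_simps)

text \<open>The adjoint of a lattice shift is the opposite shift, so taking adjoints swaps the
  factors exp (s_k) and exp (- s_k), which replaces \<open>s\<close> by \<open>- s\<close>. The
  minus sign arises because multiplication by i is skew-adjoint.\<close>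

lemma tilted_gen_adjoint:
  fixes x y :: "(int ^ 'd::finite) l2"
  shows "tilted_gen s x \<bullet> y = x \<bullet> - tilted_gen (- s) y"
proof -
  have tilted_hop: "tilted_hop s k v \<bullet> w = v \<bullet> tilted_hop (- s) k w" for k and v w :: "(int ^ 'd) l2"
    by (simp add: tilted_hop_def inner_simps inner_l2_shift)
  show ?thesis
    by (simp add: tilted_gen_def inner_l2_times_i inner_sum_left inner_sum_right tilted_hop
        tilted_hop_times_i l2_times_i_sum sum_negf)
qed

lemma tilted_hop_commute: "tilted_hop s k (tilted_hop r l x) = tilted_hop r l (tilted_hop s k x)"
  by (rule l2_eqI) (simp add: tilted_hop_def algebra_simps)

text \<open>All tilted generators are i times combinations of the identity and lattice shifts, and
  lattice shifts commute. For \<open>r = - s\<close> this is the normality of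
  \<open>tilted_gen s\<close>.\<close>

lemma tilted_gen_commute:
  fixes x :: "(int ^ 'd::finite) l2"
  shows "tilted_gen s (tilted_gen r x) = tilted_gen r (tilted_gen s x)"
proof -
  have lin: "linear (tilted_hop s k)" for s :: "real ^ 'd" and k
    using bounded_linear_tilted_hop by (rule bounded_linear.linear)
  have gen2: "tilted_gen s (tilted_gen r x) 
      = l2_times_i (l2_times_i (\<Sum>k\<in>UNIV. \<Sum>l\<in>UNIV. tilted_hop s k (tilted_hop r l x)))"
    for s r :: "real ^ 'd"
    by (simp add: tilted_gen_def tilted_hop_times_i linear_sum[OF lin] l2_times_i_sum)
  show ?thesis
    unfolding gen2 by (subst sum.swap) (simp add: tilted_hop_commute)
qed

text \<open>The factor exp (c * t) is absorbed by rescaling \<open>f\<close> with exp (c * t / 2);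
  this adds a real multiple of the identity to the generator, which leaves it normal.\<close>

lemma convex_on_tilted_gen_flow:
  fixes f :: "real \<Rightarrow> (int ^ 'd::finite) l2"
  assumes f: "\<And>t. t \<in> {a..b} \<Longrightarrow> (f has_vector_derivative tilted_gen s (f t)) (at t within {a..b})"
  shows "convex_on {a..b} (\<lambda>t. exp (c * t) * (norm (f t))\<^sup>2)"
proof -
  define L where "L x = (c / 2) *\<^sub>R x + tilted_gen s x" for x
  define L' where "L' x = (c / 2) *\<^sub>R x - tilted_gen (- s) x" for x
  define g where "g t = exp (c / 2 * t) *\<^sub>R f t" for t
  have lin: "linear (tilted_gen s)" for s :: "real ^ 'd"
    using bounded_linear_tilted_gen by (rule bounded_linear.linear)
  have "convex_on {a..b} (\<lambda>t. (norm (g t))\<^sup>2)"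
  proof (rule convex_on_norm_power2_normal_flow)
    show "bounded_linear L"
      unfolding L_def
      by (intro bounded_linear_add bounded_linear_const_scaleR bounded_linear_tilted_gen
          bounded_linear_ident)
    show "L x \<bullet> y = x \<bullet> L' y" for x y
      by (simp add: L_def L'_def inner_simps tilted_gen_adjoint)
    show "L (L' x) = L' (L x)" for x
      by (simp add: L_def L'_def linear_add[OF lin] linear_diff[OF lin] linear_scale[OF lin]
          tilted_gen_commute[of s] algebra_simps)
    fix t assume t: "t \<in> {a..b}"
    have "((\<lambda>t. exp (c / 2 * t)) has_real_derivative c / 2 * exp (c / 2 * t)) (at t within {a..b})"
      by (auto intro!: derivative_eq_intros)
    from has_vector_derivative_scaleR[OF this f[OF t]]
    show "(g has_vector_derivative L (g t)) (at t within {a..b})"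
      by (simp add: g_def[abs_def] L_def linear_scale[OF lin] algebra_simps)
  qed
  moreover have "(norm (g t))\<^sup>2 = exp (c * t) * (norm (f t))\<^sup>2" for t
    by (simp add: g_def power_mult_distrib exp_double[symmetric])
  ultimately show ?thesis by simp
qed

section \<open>Tilted solutions\<close>

text \<open>Here \<open>g n\<close> stands for the n-th derivative of \<open>g 0\<close>. Geometric
  growth of the derivatives, uniform on \<open>S\<close>, is beaten by the factorial in the
  remainder. Time is real while values are complex, so real and imaginary parts are treated
  separately.\<close>

lemma complex_Taylor_sums:
  fixes g :: "nat \<Rightarrow> real \<Rightarrow> complex"
  assumes S: "convex S" "x \<in> S" "y \<in> S"
    and der: "\<And>n t. t \<in> S \<Longrightarrow> (g n has_vector_derivative g (Suc n) t) (at t within S)"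
    and bd: "\<And>n t. t \<in> S \<Longrightarrow> cmod (g n t) \<le> M * K ^ n"
  shows "(\<lambda>n. ((y - x) ^ n / fact n) *\<^sub>R g n x) sums g 0 y"
proof -
  have real: "(\<lambda>n. (y - x) ^ n / fact n * r n x) sums r 0 y"
    if der: "\<And>n t. t \<in> S \<Longrightarrow> (r n has_real_derivative r (Suc n) t) (at t within S)"
      and bd: "\<And>n t. t \<in> S \<Longrightarrow> \<bar>r n t\<bar> \<le> M * K ^ n" for r :: "nat \<Rightarrow> real \<Rightarrow> real"
  proof -
    \<comment> \<open>The Taylor remainder bound, arranged as a constant times the n-th term of an
      exponential series, which tends to zero.\<close>
    define E where "E n = M * K * \<bar>y - x\<bar> * ((K * \<bar>y - x\<bar>) ^ n / fact n)" for n
    have bound: "\<bar>r 0 y - (\<Sum>i\<le>n. r i x * (y - x) ^ i / fact i)\<bar> \<le> E n" for n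
      using field_Taylor[of S n r "M * K ^ Suc n" x y, OF S(1) der _ S(2,3)] bd[of _ "Suc n"]
      by (simp add: E_def power_mult_distrib mult_ac)
    have "E \<longlonglongrightarrow> 0"
      unfolding E_def
      using tendsto_mult_right_zero[OF summable_LIMSEQ_zero[OF summable_exp[of "K * \<bar>y - x\<bar>"]]]
      by (simp add: divide_inverse mult.commute)
    then have "(\<lambda>n. r 0 y - (\<Sum>i\<le>n. r i x * (y - x) ^ i / fact i)) \<longlonglongrightarrow> 0"
      by (rule Lim_null_comparison[rotated]) (auto simp: bound)
    then have "(\<lambda>n. (\<Sum>i\<le>n. r i x * (y - x) ^ i / fact i)) \<longlonglongrightarrow> r 0 y"
      using tendsto_diff[OF tendsto_const[of "r 0 y"]] by fastforce
    then show ?thesis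
      by (simp add: sums_def_le mult_ac)
  qed
  have "(\<lambda>n. (y - x) ^ n / fact n * Re (g n x)) sums Re (g 0 y)"
  proof (rule real)
    show "((\<lambda>t. Re (g n t)) has_real_derivative Re (g (Suc n) t)) (at t within S)" if "t \<in> S" for n t
      using has_field_derivative_Re[OF der[OF that]] .
    show "\<bar>Re (g n t)\<bar> \<le> M * K ^ n" if "t \<in> S" for n t
      using abs_Re_le_cmod bd[OF that] order_trans by blast
  qed
  moreover have "(\<lambda>n. (y - x) ^ n / fact n * Im (g n x)) sums Im (g 0 y)"
  proof (rule real)
    show "((\<lambda>t. Im (g n t)) has_real_derivative Im (g (Suc n) t)) (at t within S)" if "t \<in> S" for n t
      using has_field_derivative_Im[OF der[OF that]] .
    show "\<bar>Im (g n t)\<bar> \<le> M * K ^ n" if "t \<in> S" for n t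
      using abs_Im_le_cmod bd[OF that] order_trans by blast
  qed
  ultimately show ?thesis by (simp add: sums_complex_iff)
qed

text \<open>For \<delta> of modulus at most 1, a factor \<delta>^2 splits off every term of order at
  least two, and (n + 2)! \<ge> n! leaves partial sums of exp K. The bound is uniform in
  \<open>N\<close>, as \<open>l2_Fatou\<close> requires, and its quadratic order in \<delta> later
  yields the time derivative.\<close>

lemma norm_Taylor_tail_le:
  fixes T :: "'a::real_normed_vector \<Rightarrow> 'a"
  assumes T: "\<And>x. norm (T x) \<le> K * norm x" and K: "0 \<le> K" and \<delta>: "\<bar>\<delta>\<bar> \<le> 1"
  shows "norm (\<Sum>n<N. (\<delta> ^ (n + 2) / fact (n + 2)) *\<^sub>R (T ^^ (n + 2)) x)
    \<le> \<delta>\<^sup>2 * (K\<^sup>2 * exp K * norm x)"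
proof -
  have pow: "norm ((T ^^ n) x) \<le> K ^ n * norm x" for n
  proof (induction n)
    case (Suc n)
    have "norm ((T ^^ Suc n) x) \<le> K * norm ((T ^^ n) x)" using T by simp
    also have "\<dots> \<le> K * (K ^ n * norm x)" using K Suc by (intro mult_left_mono) auto
    finally show ?case by (simp add: mult_ac)
  qed simp
  have summand: "norm ((\<delta> ^ (n + 2) / fact (n + 2)) *\<^sub>R (T ^^ (n + 2)) x)
      \<le> \<delta>\<^sup>2 * K\<^sup>2 * norm x * (K ^ n / fact n)" for n
  proof -
    have "\<bar>\<delta>\<bar> ^ (n + 2) \<le> \<bar>\<delta>\<bar> ^ 2"
      by (rule power_decreasing) (use \<delta> in auto)
    then have "\<bar>\<delta>\<bar> ^ (n + 2) \<le> \<delta>\<^sup>2" by simp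
    moreover have "(fact n :: real) \<le> fact (n + 2)"
      by (rule fact_mono) simp
    ultimately have "\<bar>\<delta>\<bar> ^ (n + 2) / fact (n + 2) \<le> \<delta>\<^sup>2 / fact n"
      by (intro frac_le) auto
    then have "\<bar>\<delta>\<bar> ^ (n + 2) / fact (n + 2) * norm ((T ^^ (n + 2)) x)
        \<le> \<delta>\<^sup>2 / fact n * (K ^ (n + 2) * norm x)"
      by (intro mult_mono pow) auto
    then show ?thesis
      by (simp add: power_abs abs_mult power_add mult_ac power2_eq_square)
  qed
  have "norm (\<Sum>n<N. (\<delta> ^ (n + 2) / fact (n + 2)) *\<^sub>R (T ^^ (n + 2)) x)
      \<le> (\<Sum>n<N. \<delta>\<^sup>2 * K\<^sup>2 * norm x * (K ^ n / fact n))"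
    by (intro sum_norm_le summand)
  also have "\<dots> = \<delta>\<^sup>2 * K\<^sup>2 * norm x * (\<Sum>n<N. K ^ n / fact n)"
    by (simp add: sum_distrib_left)
  also have "\<dots> \<le> \<delta>\<^sup>2 * K\<^sup>2 * norm x * exp K"
  proof (rule mult_left_mono)
    show "(\<Sum>n<N. K ^ n / fact n) \<le> exp K"
      unfolding exp_def using K summable_exp_generic[of K]
      by (auto simp: divide_inverse mult.commute intro!: sum_le_suminf)
  qed simp
  finally show ?thesis by (simp add: mult_ac)
qed

section \<open>Exponential tilts and the conjugated equation\<close>

definition tilt :: "real ^ 'd \<Rightarrow> int ^ 'd::finite \<Rightarrow> real" where
  "tilt s j = exp (\<Sum>k\<in>UNIV. s $ k * real_of_int (j $ k))"

lemma tilt_pos [simp]: "0 < tilt s j"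
  by (simp add: tilt_def)

lemma tilt_add_axis: "tilt s (j + axis k c) = exp (s $ k * real_of_int c) * tilt s j"
proof -
  have "(\<Sum>l\<in>UNIV. s $ l * real_of_int ((j + axis k c) $ l))
      = (\<Sum>l\<in>UNIV. s $ l * real_of_int (j $ l) + (if l = k then s $ l * real_of_int c else 0))"
    by (intro sum.cong) (auto simp: axis_def algebra_simps)
  then show ?thesis
    by (simp add: tilt_def sum.distrib exp_add)
qed

text \<open>This acts on arbitrary functions, so its powers can be applied to \<open>u t\<close>
  coordinate by coordinate, with no summability in play.\<close>

definition schroedinger_op :: "(int ^ 'd::finite \<Rightarrow> complex) \<Rightarrow> int ^ 'd \<Rightarrow> complex" where
  "schroedinger_op v j = \<i> * discrete_laplacian v j"

text \<open>A step along the k-th axis multiplies the tilt by exp (s_k) or exp (- s_k), and the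
  coefficients in \<open>tilted_hop\<close> cancel exactly these factors. So the tilt intertwines
  \<open>schroedinger_op\<close> with \<open>tilted_gen s\<close>.\<close>

lemma coord_tilted_gen:
  assumes x: "\<And>j. coord x j = tilt s j *\<^sub>R v j"
  shows "coord (tilted_gen s x) j = tilt s j *\<^sub>R schroedinger_op v j"
proof -
  have minus: "- axis k (1 :: int) = axis k (- 1)" for k :: 'a
    by (simp add: axis_def vec_eq_iff)
  have diff: "j - axis k 1 = j + axis k (- 1)" for k
    unfolding minus[symmetric] by simp
  have "coord (tilted_hop s k x) j = tilt s j *\<^sub>R (v (j + axis k 1) - 2 * v j + v (j - axis k 1))" for k
    unfolding tilted_hop_def diff minus
    by (simp add: x tilt_add_axis exp_minus_inverse algebra_simps scaleR_2 flip: mult_2)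
  then show ?thesis
    by (simp add: tilted_gen_def schroedinger_op_def discrete_laplacian_def flip: scaleR_sum_right)
qed

lemma coord_tilted_gen_power:
  assumes x: "\<And>j. coord x j = tilt s j *\<^sub>R v j"
  shows "coord ((tilted_gen s ^^ n) x) j = tilt s j *\<^sub>R (schroedinger_op ^^ n) v j"
proof (induction n arbitrary: j)
  case (Suc n)
  show ?case using coord_tilted_gen[OF Suc] by simp
qed (simp add: x)

text \<open>The coefficients 1, -2, 1 in each direction have total modulus 4, so each application
  multiplies the supremum bound by at most four times the dimension. This is the geometric growth
  needed for the Taylor series.\<close>

lemma schroedinger_op_power_bound:
  fixes v :: "int ^ 'd::finite \<Rightarrow> complex"
  assumes "\<And>j. cmod (v j) \<le> M"
  shows "cmod ((schroedinger_op ^^ n) v j) \<le> M * (4 * real CARD('d)) ^ n"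
proof (induction n arbitrary: j)
  case (Suc n)
  define B where "B = M * (4 * real CARD('d)) ^ n"
  define w where "w = (schroedinger_op ^^ n) v"
  have w: "cmod (w j) \<le> B" for j using Suc by (simp add: w_def B_def)
  have "cmod (w (j + axis k 1) - 2 * w j + w (j - axis k 1)) \<le> 4 * B" for k
  proof -
    have "cmod (w (j + axis k 1) - 2 * w j + w (j - axis k 1))
        \<le> cmod (w (j + axis k 1)) + cmod (2 * w j) + cmod (w (j - axis k 1))"
      by (intro norm_triangle_le add_mono norm_triangle_ineq4) auto
    also have "\<dots> \<le> 4 * B"
      using w[of "j + axis k 1"] w[of j] w[of "j - axis k 1"] by (simp add: norm_mult)
    finally show ?thesis .
  qed
  then have "cmod (discrete_laplacian w j) \<le> real CARD('d) * (4 * B)"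
    unfolding discrete_laplacian_def by (intro sum_norm_bound) auto
  then show ?case
    by (simp add: schroedinger_op_def[of w] norm_mult w_def[symmetric] B_def mult_ac)
qed (simp add: assms)

section \<open>Time regularity of solutions and of their tilts\<close>

lemma schroedinger_op_derivative:
  assumes "\<And>j. ((\<lambda>s. v s j) has_vector_derivative w j) (at t within S)"
  shows "((\<lambda>s. schroedinger_op (v s) j) has_vector_derivative schroedinger_op w j) (at t within S)"
  unfolding schroedinger_op_def discrete_laplacian_def
  by (intro has_vector_derivative_mult_right has_vector_derivative_sum
      has_vector_derivative_add has_vector_derivative_diff assms)

lemma schroedinger_op_power_derivative:
  assumes "free_schroedinger_solution u" "t \<in> {0..1}"
  shows "((\<lambda>s. (schroedinger_op ^^ n) (u s) j) has_vector_derivative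
    (schroedinger_op ^^ Suc n) (u t) j) (at t within {0..1})"
proof (induction n arbitrary: j)
  case 0
  then show ?case
    using assms by (simp add: free_schroedinger_solution_def schroedinger_op_def)
next
  case (Suc n)
  show ?case using schroedinger_op_derivative[OF Suc] by simp
qed

text \<open>A continuous curve on a compact interval is bounded in norm, and the norm dominates
  every coordinate. Uniformity in both time and site feeds the Taylor estimate.\<close>

lemma free_schroedinger_solution_bounded:
  assumes "free_schroedinger_solution u"
  obtains M where "\<And>t j. t \<in> {0..1} \<Longrightarrow> cmod (u t j) \<le> M"
proof -
  define U where "U t = l2_of (u t)" for t
  have l2: "in_l2 (u t)" and cont: "((\<lambda>s. l2_norm (\<lambda>j. u s j - u t j)) \<longlongrightarrow> 0) (at t within {0..1})"
    if "t \<in> {0..1}" for t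
    using assms that by (auto simp: free_schroedinger_solution_def l2_continuous_on_def)
  have coord: "coord (U t) = u t" if "t \<in> {0..1}" for t
    using l2[OF that] by (simp add: U_def l2_of_inverse)
  have diff: "coord (U s - U t) = (\<lambda>j. u s j - u t j)" if "s \<in> {0..1}" "t \<in> {0..1}" for s t
    using that by (simp add: fun_eq_iff coord)
  have "continuous_on {0..1} U"
    unfolding continuous_on_def
  proof
    fix t :: real assume t: "t \<in> {0..1}"
    have "((\<lambda>s. norm (U s - U t)) \<longlongrightarrow> 0) (at t within {0..1})"
      using t by (intro Lim_transform_within[OF cont[OF t] zero_less_one]) (auto simp: norm_l2_eq diff)
    then show "(U \<longlongrightarrow> U t) (at t within {0..1})"
      using tendsto_norm_zero_iff LIM_zero_cancel by blast
  qed
  then have "bounded (U ` {0..1})"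
    using compact_continuous_image compact_imp_bounded compact_Icc by blast
  then obtain M where "\<forall>x\<in>U ` {0..1}. norm x \<le> M"
    unfolding bounded_iff by blast
  then have "norm (U t) \<le> M" if "t \<in> {0..1}" for t
    using that by blast
  then have "cmod (u t j) \<le> M" if "t \<in> {0..1}" for t j
    using that norm_coord_le[of "U t" j] coord[OF that] by fastforce
  then show ?thesis using that by blast
qed

text \<open>The Taylor series of each coordinate in time, once tilted, consists of coordinates of
  the exponential series of the bounded operator \<open>tilted_gen s\<close> applied to
  \<open>F t\<close>. Its tails are bounded in norm, so Fatou gives finiteness at \<open>t'\<close>
  and a quadratic error together. The first conclusion is what gives \<open>F t'\<close> a meaning,
  as \<open>l2_of\<close> is unspecified off the space.\<close>

lemma tilted_solution_expansion:
  fixes u :: "real \<Rightarrow> int ^ 'd::finite \<Rightarrow> complex"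
  assumes u: "free_schroedinger_solution u" and t: "t \<in> {0..1}" "t' \<in> {0..1}"
    and l2: "in_l2 (\<lambda>j. tilt s j *\<^sub>R u t j)"
  defines "F \<equiv> \<lambda>t. l2_of (\<lambda>j. tilt s j *\<^sub>R u t j)"
  shows "in_l2 (\<lambda>j. tilt s j *\<^sub>R u t' j)"
    and "norm (F t' - F t - (t' - t) *\<^sub>R tilted_gen s (F t))
      \<le> (t' - t)\<^sup>2 * ((onorm (tilted_gen s))\<^sup>2 * exp (onorm (tilted_gen s)) * norm (F t))"
proof -
  define \<delta> where "\<delta> = t' - t"
  define K where "K = onorm (tilted_gen s :: (int ^ 'd) l2 \<Rightarrow> _)"
  define x where "x = F t"
  have coord_x: "coord x j = tilt s j *\<^sub>R u t j" for j
    using l2 by (simp add: x_def F_def l2_of_inverse)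
  \<comment> \<open>\<open>R N\<close> are partial sums of the series from order two on, and
    \<open>r\<close> is the function that they will be shown to approach in each coordinate.\<close>
  define R where "R N = (\<Sum>n<N. (\<delta> ^ (n + 2) / fact (n + 2)) *\<^sub>R (tilted_gen s ^^ (n + 2)) x)" for N
  define r where "r j = tilt s j *\<^sub>R (u t' j - u t j - \<delta> *\<^sub>R schroedinger_op (u t) j)" for j
  define c where "c = \<delta>\<^sup>2 * (K\<^sup>2 * exp K * norm x)"
  have bound: "norm (R N) \<le> c" for N
    unfolding R_def c_def
    by (rule norm_Taylor_tail_le)
       (use t in \<open>auto simp: K_def \<delta>_def bounded_linear_tilted_gen intro: onorm onorm_pos_le\<close>)
  obtain M where M: "\<And>t j. t \<in> {0..1} \<Longrightarrow> cmod (u t j) \<le> M"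
    using free_schroedinger_solution_bounded[OF u] by blast
  have "(\<lambda>N. coord (R N) j) \<longlonglongrightarrow> r j" for j
  proof -
    have "(\<lambda>n. (\<delta> ^ n / fact n) *\<^sub>R (schroedinger_op ^^ n) (u t) j) sums u t' j"
      unfolding \<delta>_def
      using complex_Taylor_sums[of "{0..1}" t t' "\<lambda>n s. (schroedinger_op ^^ n) (u s) j",
          OF convex_real_interval(5) t schroedinger_op_power_derivative[OF u]
            schroedinger_op_power_bound[OF M]]
      by simp
    from sums_split_initial_segment[OF this, of 2]
    have "(\<lambda>n. (\<delta> ^ (n + 2) / fact (n + 2)) *\<^sub>R (schroedinger_op ^^ (n + 2)) (u t) j) sums
        (u t' j - u t j - \<delta> *\<^sub>R schroedinger_op (u t) j)"
      by (simp add: numeral_2_eq_2 diff_diff_eq)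
    from bounded_linear.sums[OF bounded_linear_scaleR_right this, of "tilt s j"]
    show ?thesis
      by (simp add: sums_def R_def r_def coord_tilted_gen_power[OF coord_x] mult.commute
          del: funpow.simps)
  qed
  from l2_Fatou[OF this bound] have r: "in_l2 r" "norm (l2_of r) \<le> c" by auto
  have coord_r: "coord (l2_of r) = r" using r by (simp add: l2_of_inverse)
  \<comment> \<open>Adding back the terms of order zero and one exhibits the tilted solution at
    \<open>t'\<close> as an element of the space.\<close>
  define y where "y = l2_of r + x + \<delta> *\<^sub>R tilted_gen s x"
  have coord_y: "coord y = (\<lambda>j. tilt s j *\<^sub>R u t' j)"
    by (simp add: y_def fun_eq_iff coord_r r_def coord_x coord_tilted_gen[OF coord_x] algebra_simps)
  then show "in_l2 (\<lambda>j. tilt s j *\<^sub>R u t' j)"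
    by (metis in_l2_coord)
  have "F t' = y"
    unfolding F_def coord_y[symmetric] by (rule coord_inverse)
  then show "norm (F t' - F t - (t' - t) *\<^sub>R tilted_gen s (F t))
      \<le> (t' - t)\<^sup>2 * ((onorm (tilted_gen s))\<^sup>2 * exp (onorm (tilted_gen s)) * norm (F t))"
    using r(2) by (simp add: y_def x_def[symmetric] \<delta>_def[symmetric] K_def[symmetric] c_def)
qed

lemma tilted_solution_flow:
  fixes u :: "real \<Rightarrow> int ^ 'd::finite \<Rightarrow> complex"
  assumes u: "free_schroedinger_solution u" and t: "t \<in> {0..1}"
    and l2: "in_l2 (\<lambda>j. tilt s j *\<^sub>R u t j)"
  defines "F \<equiv> \<lambda>t. l2_of (\<lambda>j. tilt s j *\<^sub>R u t j)"
  shows "(F has_vector_derivative tilted_gen s (F t)) (at t within {0..1})"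
  unfolding has_vector_derivative_def
proof (rule has_derivativeI_sandwich[OF zero_less_one])
  define c where "c = (onorm (tilted_gen s))\<^sup>2 * exp (onorm (tilted_gen s)) * norm (F t)"
  show "bounded_linear (\<lambda>h. h *\<^sub>R tilted_gen s (F t))"
    by (rule bounded_linear_scaleR_left)
  show "norm (F t' - F t - (t' - t) *\<^sub>R tilted_gen s (F t)) / norm (t' - t) \<le> c * norm (t' - t)"
    if "t' \<in> {0..1}" "t' \<noteq> t" for t'
  proof -
    have "norm (F t' - F t - (t' - t) *\<^sub>R tilted_gen s (F t)) \<le> (t' - t)\<^sup>2 * c"
      using tilted_solution_expansion(2)[OF u t that(1) l2] by (simp add: c_def F_def)
    also have "\<dots> = c * norm (t' - t) * norm (t' - t)"
      by (simp add: power2_eq_square)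
    finally show ?thesis using that(2) by (simp add: pos_divide_le_eq)
  qed
  have "((\<lambda>t'. c * norm (t' - t)) \<longlongrightarrow> c * norm (t - t)) (at t within {0..1})"
    by (intro tendsto_intros)
  then show "((\<lambda>t'. c * norm (t' - t)) \<longlongrightarrow> 0) (at t within {0..1})" by simp
qed

text \<open>This passes between infinite sums and integrals over counting measure, where infinite
  values are allowed and sums and integrals of nonnegative functions can be exchanged.\<close>

lemma nn_integral_count_space_infsum:
  fixes f :: "'a \<Rightarrow> real"
  assumes "\<And>j. 0 \<le> f j"
  shows "f summable_on UNIV \<Longrightarrow> (\<integral>\<^sup>+j. ennreal (f j) \<partial>count_space UNIV) = ennreal (\<Sum>\<^sub>\<infinity>j. f j)"
    and "(\<integral>\<^sup>+j. ennreal (f j) \<partial>count_space UNIV) < \<infinity> \<Longrightarrow> f summable_on UNIV"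
proof -
  have iff: "f summable_on UNIV \<longleftrightarrow> Infinite_Set_Sum.abs_summable_on f UNIV"
    using abs_summable_equivalent[of f UNIV] assms by simp
  show "(\<integral>\<^sup>+j. ennreal (f j) \<partial>count_space UNIV) = ennreal (\<Sum>\<^sub>\<infinity>j. f j)" if "f summable_on UNIV"
    using that assms by (simp add: iff nn_integral_conv_infsetsum infsetsum_infsum)
  show "f summable_on UNIV" if "(\<integral>\<^sup>+j. ennreal (f j) \<partial>count_space UNIV) < \<infinity>"
    using that assms by (simp add: iff Infinite_Set_Sum.abs_summable_on_def integrable_iff_bounded)
qed

text \<open>This is convexity of exp (c * t) times the energy, divided by its factor at time
  \<open>t\<close>. Extended values make it hold for every \<open>s\<close>: if the energy at
  \<open>t0\<close> is infinite the right side is infinite, and otherwise finiteness spreads to all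
  times.\<close>

lemma tilted_energy_interpolation:
  fixes u :: "real \<Rightarrow> int ^ 'd::finite \<Rightarrow> complex" and s :: "real ^ 'd"
  assumes u: "free_schroedinger_solution u"
    and t: "t0 \<in> {0..1}" "t1 \<in> {0..1}" and \<theta>: "0 < \<theta>" "\<theta> < 1"
  defines "t \<equiv> (1 - \<theta>) * t0 + \<theta> * t1"
    and "E \<equiv> \<lambda>t. \<integral>\<^sup>+j. ennreal ((tilt s j * cmod (u t j))\<^sup>2) \<partial>count_space UNIV"
  shows "E t \<le> ennreal ((1 - \<theta>) * exp (c * (t0 - t))) * E t0 + ennreal (\<theta> * exp (c * (t1 - t))) * E t1"
proof (cases "E t0 = \<infinity>")
  case True
  then show ?thesis using \<theta> by (simp add: ennreal_mult_top)
next
  case False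
  define F where "F t = l2_of (\<lambda>j. tilt s j *\<^sub>R u t j)" for t
  have l2_iff: "in_l2 (\<lambda>j. tilt s j *\<^sub>R u t j) \<longleftrightarrow> (\<lambda>j. (tilt s j * cmod (u t j))\<^sup>2) summable_on UNIV" for t
    by (simp add: in_l2_def norm_mult abs_of_pos)
  have "in_l2 (\<lambda>j. tilt s j *\<^sub>R u t0 j)"
    unfolding l2_iff
    by (rule nn_integral_count_space_infsum(2)) (use False in \<open>auto simp: E_def less_top\<close>)
  then have l2: "in_l2 (\<lambda>j. tilt s j *\<^sub>R u t j)" if "t \<in> {0..1}" for t
    using tilted_solution_expansion(1)[OF u t(1) that] by blast
  have E: "E t = ennreal ((norm (F t))\<^sup>2)" if "t \<in> {0..1}" for t
  proof -
    have "E t = ennreal (\<Sum>\<^sub>\<infinity>j. (tilt s j * cmod (u t j))\<^sup>2)"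
      unfolding E_def using l2[OF that] by (intro nn_integral_count_space_infsum(1)) (auto simp: l2_iff)
    also have "(\<Sum>\<^sub>\<infinity>j. (tilt s j * cmod (u t j))\<^sup>2) = (norm (F t))\<^sup>2"
      using l2[OF that] by (simp add: F_def norm_l2_power2 l2_of_inverse norm_mult abs_of_pos)
    finally show ?thesis .
  qed
  have "convex_on {0..1} (\<lambda>t. exp (c * t) * (norm (F t))\<^sup>2)"
  proof (rule convex_on_tilted_gen_flow)
    show "(F has_vector_derivative tilted_gen s (F t)) (at t within {0..1})" if "t \<in> {0..1}" for t
      using tilted_solution_flow[OF u that l2[OF that]] by (simp add: F_def[abs_def])
  qed
  from convex_onD[OF this, of \<theta> t0 t1]
  have "exp (c * t) * (norm (F t))\<^sup>2
      \<le> (1 - \<theta>) * (exp (c * t0) * (norm (F t0))\<^sup>2) + \<theta> * (exp (c * t1) * (norm (F t1))\<^sup>2)"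
    using \<theta> t by (simp add: t_def)
  then have "exp (- c * t) * (exp (c * t) * (norm (F t))\<^sup>2) \<le> exp (- c * t) *
      ((1 - \<theta>) * (exp (c * t0) * (norm (F t0))\<^sup>2) + \<theta> * (exp (c * t1) * (norm (F t1))\<^sup>2))"
    by (rule mult_left_mono) simp
  moreover have "exp (- c * t) * (p * (exp (c * r) * q)) = p * exp (c * (r - t)) * q" for p q r
  proof -
    have "exp (c * (r - t)) = exp (- c * t) * exp (c * r)"
      by (simp add: exp_add[symmetric] algebra_simps)
    then show ?thesis by (simp only: mult_ac)
  qed
  moreover from this[of 1 t] have "exp (- c * t) * (exp (c * t) * q) = q" for q by simp
  ultimately have "(norm (F t))\<^sup>2 \<le> (1 - \<theta>) * exp (c * (t0 - t)) * (norm (F t0))\<^sup>2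
      + \<theta> * exp (c * (t1 - t)) * (norm (F t1))\<^sup>2"
    by (simp only: distrib_left)
  moreover have "t \<in> {0..1}"
    using convexD[OF convex_real_interval(5), of t0 0 1 t1 "1 - \<theta>" \<theta>] t \<theta> by (simp add: t_def)
  ultimately show ?thesis
    using \<theta> t by (simp add: E ennreal_mult[symmetric] ennreal_plus[symmetric] del: ennreal_plus)
qed

section \<open>The Bessel weight as a mixture of exponentials\<close>

text \<open>Its two-sided exponential moments are the Bessel functions: since cosh is even, K_m(x)
  is half the integral of exp (- x * cosh t + m * t) over the whole line.\<close>

definition bessel_measure :: "real \<Rightarrow> real measure" where
  "bessel_measure x = density lborel (\<lambda>t. ennreal (exp (- x * cosh t) / 2))"

lemma sets_bessel_measure [measurable_cong]: "sets (bessel_measure x) = sets borel"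
  by (simp add: bessel_measure_def)

lemma space_bessel_measure [simp]: "space (bessel_measure x) = UNIV"
  by (simp add: bessel_measure_def)

text \<open>The doubly exponential decay beats any exp (n * t). Taking n = |m| + 1 leaves a factor
  exp (- t) after the cosh is absorbed.\<close>

lemma bessel_K_integrand_le:
  fixes m :: int
  assumes x: "0 < x"
  obtains B where "0 \<le> B" "\<And>t. 0 \<le> t \<Longrightarrow> exp (- x * cosh t) * cosh (real_of_int m * t) \<le> B * exp (- t)"
proof
  define n where "n = nat \<bar>m\<bar> + 1"
  have n: "real n = \<bar>real_of_int m\<bar> + 1" by (simp add: n_def)
  define B where "B = (2 * real n / x) ^ n"
  show B: "0 \<le> B" using x by (simp add: B_def)
  fix t :: real assume t: "0 \<le> t"
  \<comment> \<open>Chosen so that n * y = x * exp t / 2 \<le> x * cosh t; then exp (- n * y) \<le>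
    y^(-n), which is \<open>B\<close> times exp (- n * t).\<close>
  define y where "y = x * exp t / (2 * real n)"
  have y: "0 < y" using x by (simp add: y_def n_def)
  have "real n * y = x * (exp t / 2)" using n by (simp add: y_def field_simps)
  also have "\<dots> \<le> x * cosh t"
    using x by (intro mult_left_mono) (auto simp: cosh_field_def)
  finally have "exp (- x * cosh t) \<le> exp (- (real n * y))" by simp
  also have "\<dots> = inverse (exp y ^ n)"
    by (simp add: exp_minus exp_of_nat_mult)
  also have "\<dots> \<le> inverse (y ^ n)"
  proof -
    have "y \<le> exp y" using exp_ge_add_one_self[of y] by linarith
    then have "y ^ n \<le> exp y ^ n" using y by (intro power_mono) auto
    then show ?thesis using y by (intro le_imp_inverse_le) auto
  qed
  also have "\<dots> = B * exp (- (real n * t))"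
    using x by (simp add: y_def B_def power_divide power_mult_distrib exp_minus exp_of_nat_mult
        exp_of_nat2_mult field_simps)
  finally have 1: "exp (- x * cosh t) \<le> B * exp (- (real n * t))" .
  have "\<bar>real_of_int m * t\<bar> = \<bar>real_of_int m\<bar> * t" using t by (simp add: abs_mult)
  then have "cosh (real_of_int m * t) = cosh (\<bar>real_of_int m\<bar> * t)"
    by (metis cosh_real_abs)
  also have "\<dots> \<le> exp (\<bar>real_of_int m\<bar> * t)"
    using t by (simp add: cosh_field_def)
  finally have "exp (- x * cosh t) * cosh (real_of_int m * t)
      \<le> B * exp (- (real n * t)) * exp (\<bar>real_of_int m\<bar> * t)"
    using 1 B by (intro mult_mono) auto
  also have "\<dots> = B * exp (- t)"
    by (simp add: n mult.assoc exp_add[symmetric] algebra_simps)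
  finally show "exp (- x * cosh t) * cosh (real_of_int m * t) \<le> B * exp (- t)" .
qed

text \<open>The Bochner integral defaults to 0 on non-integrable functions, so integrability is
  established first, by domination with \<open>B * exp (- t)\<close>.\<close>

lemma bessel_K_nn_integral:
  assumes x: "0 < x"
  shows "ennreal (bessel_K m x)
    = (\<integral>\<^sup>+t. ennreal (exp (- x * cosh t) * cosh (real_of_int m * t)) * indicator {0..} t \<partial>lborel)"
proof -
  define f where "f t = exp (- x * cosh t) * cosh (real_of_int m * t)" for t
  have [measurable]: "f \<in> borel_measurable borel"
    unfolding f_def cosh_field_def by measurable
  obtain B where B: "0 \<le> B" "\<And>t. 0 \<le> t \<Longrightarrow> f t \<le> B * exp (- t)"
    using bessel_K_integrand_le[OF x] unfolding f_def by blast
  have nonneg: "0 \<le> f t" for t by (simp add: f_def)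
  have "(\<integral>\<^sup>+t. ennreal (norm (indicator {0..} t *\<^sub>R f t)) \<partial>lborel)
      \<le> (\<integral>\<^sup>+t. ennreal (B * exp (- t)) * indicator {0..} t \<partial>lborel)"
    by (intro nn_integral_mono) (auto simp: indicator_def nonneg intro!: ennreal_leI B)
  also have "\<dots> = ennreal (0 - (- B * exp (- 0)))"
  proof (rule nn_integral_FTC_atLeast)
    show "((\<lambda>t. - B * exp (- t)) \<longlongrightarrow> 0) at_top"
      by (rule tendsto_mult_right_zero)
        (rule filterlim_compose[OF exp_at_bot filterlim_uminus_at_bot_at_top])
  qed (auto intro!: derivative_eq_intros mult_nonneg_nonneg B(1))
  also have "\<dots> < \<infinity>" by simp
  finally have int: "integrable lborel (\<lambda>t. indicator {0..} t *\<^sub>R f t)"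
    by (intro integrableI_bounded) auto
  have "ennreal (bessel_K m x) = (\<integral>\<^sup>+t. ennreal (indicator {0..} t *\<^sub>R f t) \<partial>lborel)"
    using nn_integral_eq_integral[OF int] nonneg
    by (simp add: bessel_K_def set_lebesgue_integral_def f_def)
  also have "\<dots> = (\<integral>\<^sup>+t. ennreal (f t) * indicator {0..} t \<partial>lborel)"
    by (intro nn_integral_cong) (auto simp: indicator_def)
  finally show ?thesis by (simp add: f_def)
qed

text \<open>Fold the negative half-line onto the positive one: the density is even, and exp (m * t)
  + exp (- m * t) = 2 * cosh (m * t) cancels the factor 1/2.\<close>

lemma bessel_K_eq_exponential_moment:
  assumes x: "0 < x"
  shows "ennreal (bessel_K m x) = (\<integral>\<^sup>+t. ennreal (exp (real_of_int m * t)) \<partial>bessel_measure x)"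
proof -
  define h where "h t = exp (- x * cosh t) / 2 * exp (real_of_int m * t)" for t
  have [measurable]: "h \<in> borel_measurable borel"
    unfolding h_def cosh_field_def by measurable
  have nonneg: "0 \<le> h t" for t by (simp add: h_def)
  have "(\<integral>\<^sup>+t. ennreal (exp (real_of_int m * t)) \<partial>bessel_measure x) = (\<integral>\<^sup>+t. ennreal (h t) \<partial>lborel)"
    unfolding bessel_measure_def h_def cosh_field_def
    by (subst nn_integral_density) (auto simp: ennreal_mult[symmetric] field_simps)
  also have "\<dots> = (\<integral>\<^sup>+t. ennreal (h t) * indicator {0..} t + ennreal (h t) * indicator {..<0} t \<partial>lborel)"
    by (intro nn_integral_cong) (auto simp: indicator_def)
  also have "\<dots> = (\<integral>\<^sup>+t. ennreal (h t) * indicator {0..} t \<partial>lborel)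
      + (\<integral>\<^sup>+t. ennreal (h t) * indicator {..<0} t \<partial>lborel)"
    by (rule nn_integral_add) auto
  also have "(\<integral>\<^sup>+t. ennreal (h t) * indicator {..<0} t \<partial>lborel)
      = (\<integral>\<^sup>+t. ennreal (h (- t)) * indicator {..<0} (- t) \<partial>lborel)"
    by (subst nn_integral_real_affine[of _ "- 1" 0]) auto
  also have "\<dots> = (\<integral>\<^sup>+t. ennreal (h (- t)) * indicator {0..} t \<partial>lborel)"
  \<comment> \<open>Reflection produces the open half-line, which differs from \<open>{0..}\<close>
    only in the null set {0}.\<close>
  proof (rule nn_integral_cong_AE)
    show "AE t in lborel. ennreal (h (- t)) * indicator {..<0} (- t) = ennreal (h (- t)) * indicator {0..} t"
      using AE_lborel_singleton[of "0 :: real"] by eventually_elim (auto simp: indicator_def)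
  qed
  also have "(\<integral>\<^sup>+t. ennreal (h t) * indicator {0..} t \<partial>lborel)
      + (\<integral>\<^sup>+t. ennreal (h (- t)) * indicator {0..} t \<partial>lborel)
      = (\<integral>\<^sup>+t. ennreal (h t) * indicator {0..} t + ennreal (h (- t)) * indicator {0..} t \<partial>lborel)"
    by (rule nn_integral_add[symmetric]) auto
  also have "\<dots> = (\<integral>\<^sup>+t. ennreal (exp (- x * cosh t) * cosh (real_of_int m * t)) * indicator {0..} t \<partial>lborel)"
  proof (intro nn_integral_cong)
    fix t :: real
    have exp_sum: "exp (real_of_int m * t) + exp (- (real_of_int m * t)) = 2 * cosh (real_of_int m * t)"
      by (simp add: cosh_field_def)
    have "h t + h (- t) = exp (- x * cosh t) / 2
        * (exp (real_of_int m * t) + exp (- (real_of_int m * t)))"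
      by (simp add: h_def distrib_left)
    then have "h t + h (- t) = exp (- x * cosh t) * cosh (real_of_int m * t)"
      by (simp add: exp_sum)
    then show "ennreal (h t) * indicator {0..} t + ennreal (h (- t)) * indicator {0..} t
        = ennreal (exp (- x * cosh t) * cosh (real_of_int m * t)) * indicator {0..} t"
      by (simp add: distrib_right[symmetric] ennreal_plus[symmetric] nonneg del: ennreal_plus)
  qed
  finally show ?thesis by (simp add: bessel_K_nn_integral[OF x])
qed

section \<open>Product measures and the squared weight\<close>

lemma bessel_K_nonneg: "0 \<le> bessel_K m x"
  unfolding bessel_K_def set_lebesgue_integral_def
  by (intro Bochner_Integration.integral_nonneg) simp

lemma finite_measure_bessel_measure:
  assumes "0 < x"
  shows "finite_measure (bessel_measure x)"
proof (rule finite_measureI)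
  have "ennreal (bessel_K 0 x) = emeasure (bessel_measure x) (space (bessel_measure x))"
    by (simp add: bessel_K_eq_exponential_moment[OF assms])
  then show "emeasure (bessel_measure x) (space (bessel_measure x)) \<noteq> \<infinity>"
    by (metis ennreal_neq_top infinity_ennreal_def)
qed

text \<open>By independence of coordinates under the product measure, the product of one-dimensional
  moments is the moment of the product. The measure lives on functions, which \<open>\<chi>\<close>
  turns into vectors.\<close>

lemma prod_bessel_K_eq_exponential_moment:
  fixes j :: "int ^ 'd::finite"
  assumes x: "0 < x"
  shows "ennreal (\<Prod>k\<in>UNIV. bessel_K (j $ k) x)
    = (\<integral>\<^sup>+y. ennreal (tilt (\<chi> k. y k) j) \<partial>(\<Pi>\<^sub>M k\<in>UNIV. bessel_measure x))"
proof -
  interpret finite_measure "bessel_measure x"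
    by (rule finite_measure_bessel_measure[OF x])
  interpret product_sigma_finite "\<lambda>_ :: 'd. bessel_measure x"
    by unfold_locales
  have "ennreal (\<Prod>k\<in>UNIV. bessel_K (j $ k) x)
      = (\<Prod>k\<in>UNIV. \<integral>\<^sup>+t. ennreal (exp (real_of_int (j $ k) * t)) \<partial>bessel_measure x)"
    by (simp add: prod_ennreal[symmetric] bessel_K_nonneg bessel_K_eq_exponential_moment[OF x])
  also have "\<dots> = (\<integral>\<^sup>+y. (\<Prod>k\<in>UNIV. ennreal (exp (real_of_int (j $ k) * y k)))
      \<partial>(\<Pi>\<^sub>M k\<in>UNIV. bessel_measure x))"
    by (rule product_nn_integral_prod[symmetric]) auto
  also have "\<dots> = (\<integral>\<^sup>+y. ennreal (tilt (\<chi> k. y k) j) \<partial>(\<Pi>\<^sub>M k\<in>UNIV. bessel_measure x))"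
    by (simp add: prod_ennreal tilt_def exp_sum mult.commute)
  finally show ?thesis .
qed

text \<open>Squaring the weight calls for two independent copies \<open>a\<close>, \<open>b\<close>
  of the mixing variable; the product of their tilts is the square of the tilt at the midpoint. Each
  factor is expanded in turn and its integral exchanged with the sum by Tonelli.\<close>

lemma bessel_weighted_sum_mixture:
  fixes w :: "int ^ 'd::finite \<Rightarrow> ennreal"
  assumes x: "0 < x"
  defines "P \<equiv> \<Pi>\<^sub>M k\<in>(UNIV :: 'd set). bessel_measure x"
  shows "(\<integral>\<^sup>+j. ennreal ((\<Prod>k\<in>UNIV. bessel_K (j $ k) x)\<^sup>2) * w j \<partial>count_space UNIV)
    = (\<integral>\<^sup>+a. \<integral>\<^sup>+b. \<integral>\<^sup>+j. ennreal ((tilt (\<chi> k. (a k + b k) / 2) j)\<^sup>2) * w j \<partial>count_space UNIV \<partial>P \<partial>P)"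
proof -
  define e :: "('d \<Rightarrow> real) \<Rightarrow> int ^ 'd \<Rightarrow> ennreal" where "e a j = ennreal (tilt (\<chi> k. a k) j)" for a j
  define K where "K j = ennreal (\<Prod>k\<in>UNIV. bessel_K (j $ k) x)" for j :: "int ^ 'd"
  have K: "K j = (\<integral>\<^sup>+a. e a j \<partial>P)" for j
    unfolding K_def P_def e_def by (rule prod_bessel_K_eq_exponential_moment[OF x])
  have [measurable]: "(\<lambda>a. e a j) \<in> borel_measurable P" for j
    unfolding e_def tilt_def P_def by simp
  have square: "ennreal ((tilt (\<chi> k. (a k + b k) / 2) j)\<^sup>2) = e a j * e b j" for a b and j :: "int ^ 'd"
  proof -
    have "(tilt (\<chi> k. (a k + b k) / 2) j)\<^sup>2 = tilt (\<chi> k. a k) j * tilt (\<chi> k. b k) j"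
      by (simp add: tilt_def exp_double[symmetric] exp_add[symmetric] sum_distrib_left
          sum.distrib[symmetric] algebra_simps add_divide_distrib)
    then show ?thesis by (simp add: e_def ennreal_mult less_imp_le)
  qed
  have "(\<integral>\<^sup>+j. ennreal ((\<Prod>k\<in>UNIV. bessel_K (j $ k) x)\<^sup>2) * w j \<partial>count_space UNIV)
      = (\<integral>\<^sup>+j. (\<integral>\<^sup>+a. e a j * (K j * w j) \<partial>P) \<partial>count_space UNIV)"
    by (simp add: nn_integral_multc K[symmetric] K_def power2_eq_square ennreal_mult prod_nonneg
        bessel_K_nonneg mult.assoc)
  also have "\<dots> = (\<integral>\<^sup>+a. (\<integral>\<^sup>+j. e a j * (K j * w j) \<partial>count_space UNIV) \<partial>P)"
    by (rule nn_integral_count_space_nn_integral[symmetric]) auto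
  also have "\<dots> = (\<integral>\<^sup>+a. \<integral>\<^sup>+j. \<integral>\<^sup>+b. e b j * (e a j * w j) \<partial>P \<partial>count_space UNIV \<partial>P)"
  proof -
    have "(\<integral>\<^sup>+b. e b j * (e a j * w j) \<partial>P) = K j * (e a j * w j)" for a j
      by (simp add: nn_integral_multc K)
    then show ?thesis by (simp add: mult_ac)
  qed
  also have "\<dots> = (\<integral>\<^sup>+a. \<integral>\<^sup>+b. \<integral>\<^sup>+j. e b j * (e a j * w j) \<partial>count_space UNIV \<partial>P \<partial>P)"
    by (intro nn_integral_cong nn_integral_count_space_nn_integral[symmetric]) auto
  finally show ?thesis by (simp add: square mult_ac)
qed

section \<open>Logarithmic convexity\<close>

text \<open>For positive \<open>a\<close> and \<open>b\<close> the optimal choice is y = ln a - ln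
  b, which makes both exponential terms equal to the geometric mean. Adding \<open>e > 0\<close>
  covers vanishing \<open>a\<close> or \<open>b\<close>, and \<open>e\<close> then tends to
  0.\<close>

lemma log_convex_if_exponentially_interpolated:
  fixes a b h \<theta> :: real
  assumes nonneg: "0 \<le> a" "0 \<le> b" and \<theta>: "0 < \<theta>" "\<theta> < 1"
    and le: "\<And>y. h \<le> (1 - \<theta>) * exp (- \<theta> * y) * a + \<theta> * exp ((1 - \<theta>) * y) * b"
  shows "h \<le> a powr (1 - \<theta>) * b powr \<theta>"
proof -
  have "h \<le> (a + e) powr (1 - \<theta>) * (b + e) powr \<theta>" if "0 < e" for e
  proof -
    define y where "y = ln (a + e) - ln (b + e)"
    have pos: "0 < a + e" "0 < b + e" using nonneg that by auto
    have 1: "exp (- \<theta> * y) * (a + e) = (a + e) powr (1 - \<theta>) * (b + e) powr \<theta>"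
    proof -
      have "exp (- \<theta> * y) * (a + e) = exp (- \<theta> * y + ln (a + e))"
        using pos by (simp only: exp_add exp_ln)
      also have "- \<theta> * y + ln (a + e) = (1 - \<theta>) * ln (a + e) + \<theta> * ln (b + e)"
        by (simp add: y_def algebra_simps)
      finally show ?thesis using pos by (simp add: powr_def exp_add)
    qed
    have 2: "exp ((1 - \<theta>) * y) * (b + e) = (a + e) powr (1 - \<theta>) * (b + e) powr \<theta>"
    proof -
      have "exp ((1 - \<theta>) * y) * (b + e) = exp ((1 - \<theta>) * y + ln (b + e))"
        using pos by (simp only: exp_add exp_ln)
      also have "(1 - \<theta>) * y + ln (b + e) = (1 - \<theta>) * ln (a + e) + \<theta> * ln (b + e)"
        by (simp add: y_def algebra_simps)
      finally show ?thesis using pos by (simp add: powr_def exp_add)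
    qed
    have "h \<le> (1 - \<theta>) * exp (- \<theta> * y) * a + \<theta> * exp ((1 - \<theta>) * y) * b"
      by (rule le)
    also have "\<dots> \<le> (1 - \<theta>) * exp (- \<theta> * y) * (a + e) + \<theta> * exp ((1 - \<theta>) * y) * (b + e)"
      using \<theta> that by (intro add_mono mult_left_mono) auto
    also have "\<dots> = (1 - \<theta>) * ((a + e) powr (1 - \<theta>) * (b + e) powr \<theta>)
        + \<theta> * ((a + e) powr (1 - \<theta>) * (b + e) powr \<theta>)"
      unfolding mult.assoc 1 2 ..
    finally show ?thesis by (simp add: algebra_simps)
  qed
  then have "\<forall>\<^sub>F e in at_right 0. h \<le> (a + e) powr (1 - \<theta>) * (b + e) powr \<theta>"
    by (auto simp: eventually_at_filter)
  \<comment> \<open>Where a base tends to 0, continuity of the power rests on the exponents being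
    positive.\<close>
  moreover have "((\<lambda>e. (a + e) powr (1 - \<theta>) * (b + e) powr \<theta>) \<longlongrightarrow> (a + 0) powr (1 - \<theta>) * (b + 0) powr \<theta>)
      (at_right 0)"
    using nonneg \<theta>
    by (intro tendsto_mult tendsto_powr' tendsto_add tendsto_const tendsto_ident_at)
       (auto simp: eventually_at_filter)
  ultimately show ?thesis
    using tendsto_lowerbound[of _ _ "at_right (0 :: real)" h] by fastforce
qed

theorem theorem2p2:
  fixes u :: "real \<Rightarrow> int ^ 'd::finite \<Rightarrow> complex"
    and C lam :: real
    and z :: "int ^ 'd \<Rightarrow> real"
    and H :: "real \<Rightarrow> real"
  assumes "lam > 0" and "C > 0"
    and "\<And>j. z j = bessel_weight C lam j"
    and "free_schroedinger_solution u"
    and "(\<lambda>j. (z j)\<^sup>2 * (cmod (u 0 j))\<^sup>2) summable_on UNIV"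
    and "(\<lambda>j. (z j)\<^sup>2 * (cmod (u 1 j))\<^sup>2) summable_on UNIV"
    and "\<And>t. H t = (\<Sum>\<^sub>\<infinity>j. (z j)\<^sup>2 * (cmod (u t j))\<^sup>2)"
  shows "(\<forall>t\<in>{0..1}. (\<lambda>j. (z j)\<^sup>2 * (cmod (u t j))\<^sup>2) summable_on UNIV) \<and>
         log_convex_unit_interval H"
proof -
  define x where "x = 1 / (2 * lam)"
  have x: "0 < x" using \<open>lam > 0\<close> by (simp add: x_def)
  define K where "K j = (\<Prod>k\<in>UNIV. bessel_K (j $ k) x)" for j :: "int ^ 'd"
  define P where "P = (\<Pi>\<^sub>M k\<in>(UNIV :: 'd set). bessel_measure x)"
  define S where "S w = (\<integral>\<^sup>+j. ennreal ((K j)\<^sup>2) * w j \<partial>count_space UNIV)" for w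
  define T where "T s w = (\<integral>\<^sup>+j. ennreal ((tilt s j)\<^sup>2) * w j \<partial>count_space UNIV)"
    for s :: "real ^ 'd" and w
  define w where "w t j = ennreal ((cmod (u t j))\<^sup>2)" for t j
  define E where "E t = (\<integral>\<^sup>+j. ennreal ((z j)\<^sup>2 * (cmod (u t j))\<^sup>2) \<partial>count_space UNIV)" for t
  have S_mix: "S w = (\<integral>\<^sup>+a. \<integral>\<^sup>+b. T (\<chi> k. (a k + b k) / 2) w \<partial>P \<partial>P)" for w
    unfolding S_def T_def K_def P_def by (rule bessel_weighted_sum_mixture[OF x])
  have E_S: "E t = ennreal (C\<^sup>2) * S (w t)" for t
    unfolding E_def S_def assms(3)
    by (simp add: nn_integral_cmult[symmetric] bessel_weight_def K_def x_def w_def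
        power_mult_distrib ennreal_mult mult.assoc)
  have interp: "E t \<le> ennreal \<alpha> * E t0 + ennreal \<beta> * E t1"
    if "t0 \<in> {0..1}" "t1 \<in> {0..1}" "0 < \<theta>" "\<theta> < 1" and t: "t = (1 - \<theta>) * t0 + \<theta> * t1"
      and ab: "\<alpha> = (1 - \<theta>) * exp (c * (t0 - t))" "\<beta> = \<theta> * exp (c * (t1 - t))"
    for t0 t1 t \<theta> \<alpha> \<beta> c
  proof -
    \<comment> \<open>Packing the right side into one sequence lets the inequality pass from every
      \<open>T s\<close> to \<open>S\<close> by monotonicity alone; linearity is then used only for
      sums over the lattice.\<close>
    define v where "v j = ennreal \<alpha> * w t0 j + ennreal \<beta> * w t1 j" for j
    have "T s (w t) \<le> T s v" for s
    proof -
      have T: "T s (w r) = (\<integral>\<^sup>+j. ennreal ((tilt s j * cmod (u r j))\<^sup>2) \<partial>count_space UNIV)" for r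
        by (simp add: T_def w_def power_mult_distrib ennreal_mult)
      have "T s v = ennreal \<alpha> * T s (w t0) + ennreal \<beta> * T s (w t1)"
        by (simp add: T_def v_def distrib_left nn_integral_add nn_integral_cmult[symmetric] mult_ac)
      then show ?thesis
        using tilted_energy_interpolation[OF assms(4) that(1-4), of s c] by (simp add: T t ab)
    qed
    then have "S (w t) \<le> S v"
      unfolding S_mix by (intro nn_integral_mono)
    also have "S v = ennreal \<alpha> * S (w t0) + ennreal \<beta> * S (w t1)"
      by (simp add: S_def v_def distrib_left nn_integral_add nn_integral_cmult[symmetric] mult_ac)
    finally have "E t \<le> ennreal (C\<^sup>2) * (ennreal \<alpha> * S (w t0) + ennreal \<beta> * S (w t1))"
      unfolding E_S by (rule mult_left_mono) simp
    then show ?thesis by (simp add: E_S distrib_left mult_ac)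
  qed
  have E_H: "E t = ennreal (H t)" if "(\<lambda>j. (z j)\<^sup>2 * (cmod (u t j))\<^sup>2) summable_on UNIV" for t
    unfolding E_def assms(7) using that by (intro nn_integral_count_space_infsum(1)) auto
  have summable: "(\<lambda>j. (z j)\<^sup>2 * (cmod (u t j))\<^sup>2) summable_on UNIV" if t: "t \<in> {0..1}" for t
  proof (cases "t = 0 \<or> t = 1")
    case True
    then show ?thesis using assms(5,6) by auto
  next
    case False
    \<comment> \<open>With c = 0 the interpolation is plain convexity, enough for finiteness at
      intermediate times.\<close>
    have "E t \<le> ennreal (1 - t) * E 0 + ennreal t * E 1"
      using interp[of 0 1 t t "1 - t" 0 t] t False by simp
    also have "\<dots> < \<infinity>"
      by (simp add: E_H assms(5,6) ennreal_mult_less_top)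
    finally show ?thesis
      unfolding E_def by (intro nn_integral_count_space_infsum(2)) auto
  qed
  have H_nonneg: "0 \<le> H t" for t
    unfolding assms(7) by (intro infsum_nonneg) simp
  have "H ((1 - \<theta>) * t0 + \<theta> * t1) \<le> H t0 powr (1 - \<theta>) * H t1 powr \<theta>"
    if t: "t0 \<in> {0..1}" "t1 \<in> {0..1}" and \<theta>: "\<theta> \<in> {0<..<1}" for t0 t1 \<theta>
  \<comment> \<open>Equal times are separated because \<open>c\<close> below divides by
    \<open>t1 - t0\<close>; there the claim is an equality, with \<open>0 powr _ = 0\<close> when
    \<open>H t1\<close> vanishes.\<close>
  proof (cases "t0 = t1")
    case True
    then show ?thesis
      using H_nonneg[of t1] by (cases "H t1 = 0") (auto simp: powr_add[symmetric] algebra_simps)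
  next
    case False
    define t where "t = (1 - \<theta>) * t0 + \<theta> * t1"
    have t01: "t \<in> {0..1}"
      using convexD[OF convex_real_interval(5), of t0 0 1 t1 "1 - \<theta>" \<theta>] t \<theta> by (simp add: t_def)
    have "H t \<le> H t0 powr (1 - \<theta>) * H t1 powr \<theta>"
    proof (rule log_convex_if_exponentially_interpolated)
      fix y
      \<comment> \<open>As t0 - t = - \<theta> * (t1 - t0) and t1 - t = (1 - \<theta>) * (t1 - t0),
        this produces exactly the exponents of the optimisation lemma.\<close>
      define c where "c = y / (t1 - t0)"
      have c: "c * (t0 - t) = - \<theta> * y" "c * (t1 - t) = (1 - \<theta>) * y"
        using False by (simp_all add: c_def t_def field_simps)
      have "E t \<le> ennreal ((1 - \<theta>) * exp (- \<theta> * y)) * E t0 + ennreal (\<theta> * exp ((1 - \<theta>) * y)) * E t1"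
        by (rule interp[OF t, of \<theta> t _ c]) (use \<theta> in \<open>simp_all only: c t_def[symmetric] greaterThanLessThan_iff\<close>)
      moreover have "E t = ennreal (H t)" "E t0 = ennreal (H t0)" "E t1 = ennreal (H t1)"
        using E_H summable t t01 by blast+
      ultimately show "H t \<le> (1 - \<theta>) * exp (- \<theta> * y) * H t0 + \<theta> * exp ((1 - \<theta>) * y) * H t1"
        using \<theta> H_nonneg
        by (simp add: ennreal_mult[symmetric] ennreal_plus[symmetric] del: ennreal_plus)
    qed (use \<theta> H_nonneg in auto)
    then show ?thesis by (simp add: t_def)
  qed
  then show ?thesis
    using summable H_nonneg by (auto simp: log_convex_unit_interval_def)
qed

end
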